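(* For every integer $n \geq 4$, let $H_n = (V_n, E_n)$ be the $3$-uniform hypergraph whose vertices are the edges of the complete graph $K_n$ on $[n] = \{1,\dots,n\}$ and in which three vertices form an edge if and only if the three corresponding edges of $K_n$ form a triangle in $K_n$. Then $\vartheta(H_n) = n^2/4$.
   Context: For an integer $r \geq 1$, an $r$-uniform hypergraph $H=(V,E)$ consists of a finite set $V$ and a set $E$ of $r$-element subsets of $V$. A set $I \subseteq V$ is independent in $H$ if no edge of $H$ is contained in $I$. $\mathrm{IND}(H) = \mathrm{conv}\{\chi_I \in \mathbb{R}^V : I \subseteq V \text{ independent}\}$, where $\chi_I$ is the characteristic function of $I$. For $r \geq 2$ and $x \in V$, the link of $x$ in $H$ is the $(r-1)$-uniform hypergraph $H_x$ with vertex set $V_x = \{ y \in V \setminus\{x\} : \text{there is } e \in E \text{ containing } x \text{ and } y\}$, in which an $(r-1)$-subset $e$ of $V_x$ is an edge if and only if $e \cup \{x\} \in E$. For $A \in \mathbb{R}^{V\times V}$, $A_x \in \mathbb{R}^V$ is the row indexed by $x$; $f[U]$ is the restriction of $f$ to $U \subseteq V$. Positive semidefinite matrices are always symmetric. For a symmetric matrix $A$ with diagonal $a$, write $R(A) = \begin{pmatrix} 1 & a^{\mathsf T} \\ a & A\end{pmatrix}$. The theta body $\mathrm{TH}(H)$ is defined recursively. For $r = 1$, $\mathrm{TH}(H) = \mathrm{IND}(H)$. For $r \geq 2$, $\mathrm{TH}(H)$ is the set of all $f \in \mathbb{R}^V$ for which there is $F \in \mathbb{R}^{V \times V}$ such that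 $f = \mathrm{diag}\,F$, $F_x[V_x] \in F(x,x)\,\mathrm{TH}(H_x)$ for every $x \in V$ (no constraint is imposed on row $F_x$ if the link $H_x$ is empty), and $R(F)$ is positive semidefinite. The (unweighted) theta number is $\vartheta(H) = \max\{ \sum_{x \in V} f(x) : f \in \mathrm{TH}(H)\}$. *)

theory Defs
  imports "HOL-Analysis.Analysis"
begin

section \<open>Uniform hypergraphs\<close>

definition uniform_hypergraph :: "nat \<Rightarrow> 'a set \<Rightarrow> 'a set set \<Rightarrow> bool" where
  "uniform_hypergraph r V E \<longleftrightarrow> 1 \<le> r \<and> finite V \<and> (\<forall>e\<in>E. e \<subseteq> V \<and> card e = r)"

definition independent_sets :: "'a set \<Rightarrow> 'a set set \<Rightarrow> 'a set set" where
  "independent_sets V E = {I. I \<subseteq> V \<and> \<not> (\<exists>e\<in>E. e \<subseteq> I)}"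

definition link_verts :: "'a set \<Rightarrow> 'a set set \<Rightarrow> 'a \<Rightarrow> 'a set" where
  "link_verts V E x = {y \<in> V - {x}. \<exists>e\<in>E. x \<in> e \<and> y \<in> e}"

definition link_edges :: "nat \<Rightarrow> 'a set \<Rightarrow> 'a set set \<Rightarrow> 'a \<Rightarrow> 'a set set" where
  "link_edges r V E x = {e. e \<subseteq> link_verts V E x \<and> card e = r - 1 \<and> insert x e \<in> E}"

lemma uniform_hypergraph_link:
  assumes "uniform_hypergraph r V E" and "2 \<le> r"
  shows "uniform_hypergraph (r - 1) (link_verts V E x) (link_edges r V E x)"
  using assms by (auto simp: uniform_hypergraph_def link_verts_def link_edges_def)

section \<open>The theta body\<close>

text \<open>
  A vector of \<open>\<real>\<^sup>V\<close> is represented by the function \<open>'a \<Rightarrow> real\<close> that extends it by zero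
  outside \<open>V\<close>. Matrices are only ever inspected on their index set.
\<close>

text \<open>
  The function type is not an instance of \<^class>\<open>real_vector\<close>, so the convex hull of the
  (finitely many) characteristic vectors is written out as the set of their convex combinations.
\<close>

definition IND :: "'a set \<Rightarrow> 'a set set \<Rightarrow> ('a \<Rightarrow> real) set" where
  "IND V E = {f. \<exists>c. (\<forall>I\<in>independent_sets V E. 0 \<le> c I) \<and>
      (\<Sum>I\<in>independent_sets V E. c I) = 1 \<and>
      f = (\<lambda>x. \<Sum>I\<in>independent_sets V E. c I * indicator I x)}"

definition psd_on :: "'i set \<Rightarrow> ('i \<Rightarrow> 'i \<Rightarrow> real) \<Rightarrow> bool" where
  "psd_on S M \<longleftrightarrow> (\<forall>i\<in>S. \<forall>j\<in>S. M i j = M j i) \<and>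
     (\<forall>v :: 'i \<Rightarrow> real. 0 \<le> (\<Sum>i\<in>S. \<Sum>j\<in>S. v i * M i j * v j))"

text \<open>
  The bordered matrix \<open>R(A)\<close> is indexed by \<open>insert None (Some ` V)\<close>; the index \<open>None\<close> is the
  additional first row and column.
\<close>

fun bordered :: "('a \<Rightarrow> 'a \<Rightarrow> real) \<Rightarrow> 'a option \<Rightarrow> 'a option \<Rightarrow> real" where
  "bordered A None None = 1"
| "bordered A None (Some y) = A y y"
| "bordered A (Some x) None = A x x"
| "bordered A (Some x) (Some y) = A x y"

text \<open>Only uniformities \<open>r \<ge> 1\<close> are meaningful; the value at \<open>r = 0\<close> is left unspecified.\<close>

fun theta_body :: "nat \<Rightarrow> 'a set \<Rightarrow> 'a set set \<Rightarrow> ('a \<Rightarrow> real) set" where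
  "theta_body (Suc 0) V E = IND V E"
| "theta_body (Suc (Suc r)) V E =
    {f. (\<forall>x. x \<notin> V \<longrightarrow> f x = 0) \<and>
      (\<exists>F :: 'a \<Rightarrow> 'a \<Rightarrow> real.
        (\<forall>x\<in>V. f x = F x x) \<and>
        (\<forall>x\<in>V. link_verts V E x \<noteq> {} \<longrightarrow>
          (\<exists>g\<in>theta_body (Suc r) (link_verts V E x) (link_edges (Suc (Suc r)) V E x).
             \<forall>y\<in>link_verts V E x. F x y = F x x * g y)) \<and>
        psd_on (insert None (Some ` V)) (bordered F))}"

definition theta_number :: "nat \<Rightarrow> 'a set \<Rightarrow> 'a set set \<Rightarrow> real" where
  "theta_number r V E = (GREATEST t. \<exists>f\<in>theta_body r V E. t = (\<Sum>x\<in>V. f x))"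

section \<open>The triangle hypergraph of the complete graph\<close>

definition complete_edges :: "nat \<Rightarrow> nat set set" where
  "complete_edges n = {e. e \<subseteq> {1..n} \<and> card e = 2}"

definition triangle_edges :: "nat \<Rightarrow> nat set set set" where
  "triangle_edges n = {{{a, b}, {b, c}, {a, c}} | a b c.
     a \<in> {1..n} \<and> b \<in> {1..n} \<and> c \<in> {1..n} \<and> a \<noteq> b \<and> b \<noteq> c \<and> a \<noteq> c}"

lemma uniform_hypergraph_triangles:
  "uniform_hypergraph 3 (complete_edges n) (triangle_edges n)"
proof -
  have "finite (complete_edges n)"
    by (rule finite_subset[of _ "Pow {1..n}"]) (auto simp: complete_edges_def)
  moreover have "e \<subseteq> complete_edges n \<and> card e = 3" if "e \<in> triangle_edges n" for e
    using that
    by (auto simp: triangle_edges_def complete_edges_def doubleton_eq_iff card_insert_if)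
  ultimately show ?thesis
    by (simp add: uniform_hypergraph_def)
qed

end

theory Submission
  imports Defs
begin

text \<open>
  Write \<open>s\<^sub>i\<close> for the characteristic vector of the star of the point \<open>i\<close>, that is, of the set of
  edges of \<open>K\<^sub>n\<close> at \<open>i\<close>.

  Upper bound. The link of an edge \<open>{a, b}\<close> is a perfect matching that pairs \<open>{a, c}\<close> with
  \<open>{b, c}\<close>, so a feasible matrix \<open>F\<close> satisfies
  \<open>F {a, b} {a, c} + F {a, b} {b, c} \<le> F {a, b} {a, b}\<close>
  (\<open>theta_body_two_edge\<close>, \<open>triangle_inequality_matrix\<close>). Summing over \<open>c\<close> bounds
  \<open>\<Sum>\<^sub>i s\<^sub>i\<^sup>T F s\<^sub>i\<close> by \<open>n\<close> times the trace \<open>t\<close> of \<open>F\<close>. In the bipartite graph that is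
  extremal for even \<open>n\<close> all degrees are \<open>n / 2\<close>; this suggests to test the bordered matrix on
  the vectors \<open>(-n / 2, s\<^sub>i)\<close>. Adding up the resulting \<open>n\<close> inequalities gives
  \<open>0 \<le> n\<^sup>3 / 4 - 2 n t + n t\<close>, which is \<open>t \<le> n\<^sup>2 / 4\<close>.

  Lower bound. Let \<open>F\<close> be invariant under the symmetric group, with entry \<open>\<alpha> = n / (2 (n - 1))\<close>
  on the diagonal, \<open>\<alpha> / 2\<close> at edges that meet in a point and
  \<open>\<gamma> = \<alpha> (n - 2) / (2 (n - 3))\<close> at disjoint edges. The rows lie in the theta bodies of the
  links because in a perfect matching the constant vector \<open>1 / 2\<close> is the mean of two
  characteristic vectors of independent sets. The Johnson scheme \<open>J(n, 2)\<close> has three common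
  eigenspaces, and with the all-ones matrix \<open>J\<close> the entries are chosen
  such that \<open>F - \<alpha>\<^sup>2 J\<close> is \<open>\<gamma>\<close> times the projection onto
  the vectors all of whose star sums vanish. Positivity is therefore the fact that a
  projection does not increase the norm (\<open>star_sums_square_bound\<close>).
\<close>

section \<open>Quadratic forms of bordered matrices\<close>

lemma bordered_form:
  assumes "finite V"
  shows "(\<Sum>i\<in>insert None (Some ` V). \<Sum>j\<in>insert None (Some ` V). v i * bordered A i j * v j)
    = (v None)\<^sup>2 + 2 * v None * (\<Sum>x\<in>V. A x x * v (Some x))
      + (\<Sum>x\<in>V. \<Sum>y\<in>V. v (Some x) * A x y * v (Some y))"
  using assms
  by (simp add: sum.reindex sum.distrib sum_distrib_left power2_eq_square mult_ac)

lemma psd_bordered_iff: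
  assumes "finite V"
  shows "psd_on (insert None (Some ` V)) (bordered A) \<longleftrightarrow>
    (\<forall>x\<in>V. \<forall>y\<in>V. A x y = A y x) \<and>
    (\<forall>s v. 0 \<le> s\<^sup>2 + 2 * s * (\<Sum>x\<in>V. A x x * v x) + (\<Sum>x\<in>V. \<Sum>y\<in>V. v x * A x y * v y))"
    (is "?L \<longleftrightarrow> ?S \<and> ?P")
proof -
  have "?P" if "?L"
  proof (intro allI)
    fix s and v :: "'a \<Rightarrow> real"
    have "0 \<le> (\<Sum>i\<in>insert None (Some ` V). \<Sum>j\<in>insert None (Some ` V).
        case_option s v i * bordered A i j * case_option s v j)"
      using that by (simp only: psd_on_def)
    then show "0 \<le> s\<^sup>2 + 2 * s * (\<Sum>x\<in>V. A x x * v x) + (\<Sum>x\<in>V. \<Sum>y\<in>V. v x * A x y * v y)"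
      by (simp only: bordered_form[OF assms] option.case)
  qed
  moreover have "?S" if "?L"
    using that by (auto simp: psd_on_def)
  moreover have "?L" if "?S" "?P"
  proof -
    have "\<forall>i\<in>insert None (Some ` V). \<forall>j\<in>insert None (Some ` V). bordered A i j = bordered A j i"
      using that(1) by auto
    moreover have "0 \<le> (v None)\<^sup>2 + 2 * v None * (\<Sum>x\<in>V. A x x * v (Some x))
        + (\<Sum>x\<in>V. \<Sum>y\<in>V. v (Some x) * A x y * v (Some y))" for v
      using that(2)[rule_format, of "v None" "\<lambda>x. v (Some x)"] .
    ultimately show ?thesis
      unfolding psd_on_def bordered_form[OF assms] by blast
  qed
  ultimately show ?thesis by blast
qed

lemma psd_bordered_diagonal:
  assumes "finite V" "psd_on (insert None (Some ` V)) (bordered A)" "x \<in> V"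
  shows "0 \<le> A x x"
proof -
  define v where "v = (\<lambda>y. if y = x then 1 else 0 :: real)"
  have restrict: "(\<Sum>z\<in>V. h z * v z) = h x" for h
  proof -
    have "(\<Sum>z\<in>V. h z * v z) = (\<Sum>z\<in>{x}. h z * v z)"
      using assms(1,3) by (intro sum.mono_neutral_right) (auto simp: v_def)
    then show ?thesis by (simp add: v_def)
  qed
  have "0 \<le> 0\<^sup>2 + 2 * 0 * (\<Sum>y\<in>V. A y y * v y) + (\<Sum>y\<in>V. \<Sum>z\<in>V. v y * A y z * v z)"
    using assms(2) unfolding psd_bordered_iff[OF assms(1)] by blast
  moreover have "(\<Sum>y\<in>V. \<Sum>z\<in>V. v y * A y z * v z) = (\<Sum>y\<in>V. (\<Sum>z\<in>V. A y z * v z) * v y)"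
    by (simp add: sum_distrib_left mult_ac)
  ultimately show ?thesis by (simp add: restrict)
qed

text \<open>The test vector is \<open>-1\<close> at the border and \<open>1\<close> at \<open>x\<close> and \<open>y\<close>.\<close>

lemma psd_bordered_nonadjacent:
  assumes "finite V" "psd_on (insert None (Some ` V)) (bordered A)"
    and xy: "x \<in> V" "y \<in> V" "x \<noteq> y" "A x y = 0"
  shows "A x x + A y y \<le> 1"
proof -
  define v where "v = (\<lambda>z. if z \<in> {x, y} then 1 else 0 :: real)"
  have restrict: "(\<Sum>z\<in>V. h z * v z) = h x + h y" for h
  proof -
    have "(\<Sum>z\<in>V. h z * v z) = (\<Sum>z\<in>{x, y}. h z * v z)"
      using assms(1) xy by (intro sum.mono_neutral_right) (auto simp: v_def)
    then show ?thesis using xy by (simp add: v_def)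
  qed
  have sym: "A y x = 0"
    using assms(2) xy unfolding psd_bordered_iff[OF assms(1)] by metis
  have "(\<Sum>z\<in>V. \<Sum>w\<in>V. v z * A z w * v w) = (\<Sum>z\<in>V. (\<Sum>w\<in>V. A z w * v w) * v z)"
    by (simp add: sum_distrib_left mult_ac)
  also have "\<dots> = A x x + A y y"
    by (simp add: restrict xy(4) sym)
  finally have "(\<Sum>z\<in>V. \<Sum>w\<in>V. v z * A z w * v w) = A x x + A y y" .
  moreover have "0 \<le> (-1)\<^sup>2 + 2 * (-1) * (\<Sum>z\<in>V. A z z * v z)
      + (\<Sum>z\<in>V. \<Sum>w\<in>V. v z * A z w * v w)"
    using assms(2) unfolding psd_bordered_iff[OF assms(1)] by blast
  ultimately show ?thesis by (simp add: restrict)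
qed

section \<open>The theta body of a graph\<close>

lemma zero_in_IND:
  assumes "finite V" "{} \<notin> E"
  shows "(\<lambda>x. 0) \<in> IND V E"
proof -
  let ?c = "\<lambda>I :: 'a set. if I = {} then 1 else 0 :: real"
  have "finite (independent_sets V E)"
    by (rule finite_subset[of _ "Pow V"]) (use assms in \<open>auto simp: independent_sets_def\<close>)
  moreover have "{} \<in> independent_sets V E"
    using assms by (auto simp: independent_sets_def)
  moreover have "(\<lambda>x. \<Sum>I\<in>independent_sets V E. ?c I * indicator I x) = (\<lambda>x :: 'a. 0 :: real)"
    by (intro ext sum.neutral) auto
  ultimately show ?thesis
    unfolding IND_def by (intro CollectI exI[of _ ?c]) (auto simp: sum.delta)
qed

lemma IND_singleton_edge:
  assumes "f \<in> IND V E" "{x} \<in> E"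
  shows "f x = 0"
proof -
  obtain c where "f = (\<lambda>x. \<Sum>I\<in>independent_sets V E. c I * indicator I x)"
    using assms(1) by (auto simp: IND_def)
  moreover have "(\<Sum>I\<in>independent_sets V E. c I * indicator I x) = 0"
    using assms(2) by (intro sum.neutral) (auto simp: independent_sets_def indicator_def)
  ultimately show ?thesis by simp
qed

text \<open>
  The link of a vertex of a graph consists of loops at the neighbours of that vertex, so the
  recursion forces \<open>F x y = 0\<close> on the edges \<open>{x, y}\<close>, as in the definition of the Lovasz theta
  body. Edge inequalities follow.
\<close>

lemma theta_body_two_edge:
  assumes "finite V" "g \<in> theta_body (Suc (Suc 0)) V E"
    and xy: "x \<in> V" "y \<in> V" "x \<noteq> y" "{x, y} \<in> E"
  shows "g x + g y \<le> 1"
proof -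
  obtain G where G: "\<forall>x\<in>V. g x = G x x"
    "\<And>x. x \<in> V \<Longrightarrow> link_verts V E x \<noteq> {} \<Longrightarrow>
      \<exists>h\<in>IND (link_verts V E x) (link_edges (Suc (Suc 0)) V E x).
        \<forall>y\<in>link_verts V E x. G x y = G x x * h y"
    "psd_on (insert None (Some ` V)) (bordered G)"
    using assms(2) by (simp only: theta_body.simps mem_Collect_eq) blast
  have y: "y \<in> link_verts V E x" "{y} \<in> link_edges (Suc (Suc 0)) V E x"
    using xy by (auto simp: link_verts_def link_edges_def)
  then obtain h where "h \<in> IND (link_verts V E x) (link_edges (Suc (Suc 0)) V E x)"
    "G x y = G x x * h y"
    using G(2)[of x] xy(1) by blast
  then have "G x y = 0"
    using IND_singleton_edge y by fastforce
  then show ?thesis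
    using psd_bordered_nonadjacent[OF assms(1) G(3)] xy G(1) by fastforce
qed

text \<open>
  The mean of the characteristic vectors \<open>\<chi>\<close> of the two colour classes, together with the mean
  of the matrices \<open>\<chi> \<chi>\<^sup>T\<close>.
\<close>

lemma theta_body_two_half:
  assumes "finite V"
    and colouring: "\<And>y z. {y, z} \<in> E \<Longrightarrow> y \<noteq> z \<Longrightarrow> P y \<longleftrightarrow> \<not> P z"
    and uniform: "\<And>e. e \<in> E \<Longrightarrow> card e = 2"
  shows "(\<lambda>x. if x \<in> V then 1 / 2 else 0) \<in> theta_body (Suc (Suc 0)) V E"
proof -
  define G :: "'a \<Rightarrow> 'a \<Rightarrow> real" where "G = (\<lambda>y z. if P y \<longleftrightarrow> P z then 1 / 2 else 0)"
  have "psd_on (insert None (Some ` V)) (bordered G)"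
    unfolding psd_bordered_iff[OF assms(1)]
  proof (intro conjI allI)
    fix s :: real and v :: "'a \<Rightarrow> real"
    define p where "p = (\<Sum>x\<in>V. if P x then v x else 0)"
    define q where "q = (\<Sum>x\<in>V. if P x then 0 else v x)"
    have "(\<Sum>x\<in>V. G x x * v x) = (p + q) / 2"
      unfolding p_def q_def sum.distrib[symmetric] sum_divide_distrib
      by (intro sum.cong) (auto simp: G_def)
    moreover have "(\<Sum>x\<in>V. \<Sum>y\<in>V. v x * G x y * v y) = (p * p + q * q) / 2"
      unfolding p_def q_def sum_product sum.distrib[symmetric] sum_divide_distrib
      by (intro sum.cong) (auto simp: G_def)
    moreover have "s\<^sup>2 + 2 * s * ((p + q) / 2) + (p * p + q * q) / 2 = ((s + p)\<^sup>2 + (s + q)\<^sup>2) / 2"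
      by (simp add: power2_eq_square field_simps)
    ultimately have "s\<^sup>2 + 2 * s * (\<Sum>x\<in>V. G x x * v x) + (\<Sum>x\<in>V. \<Sum>y\<in>V. v x * G x y * v y)
        = ((s + p)\<^sup>2 + (s + q)\<^sup>2) / 2"
      by metis
    moreover have "0 \<le> ((s + p)\<^sup>2 + (s + q)\<^sup>2) / 2"
      by simp
    ultimately show "0 \<le> s\<^sup>2 + 2 * s * (\<Sum>x\<in>V. G x x * v x) + (\<Sum>x\<in>V. \<Sum>y\<in>V. v x * G x y * v y)"
      by (simp only:)
  qed (auto simp: G_def)
  moreover have "\<exists>h\<in>IND (link_verts V E x) (link_edges (Suc (Suc 0)) V E x).
      \<forall>y\<in>link_verts V E x. G x y = G x x * h y" for x
  proof (intro bexI[of _ "\<lambda>_. 0"] ballI)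
    fix y assume "y \<in> link_verts V E x"
    then obtain e where e: "e \<in> E" "x \<in> e" "y \<in> e" "y \<noteq> x"
      by (auto simp: link_verts_def)
    then have "e = {x, y}"
      using uniform[OF e(1)] by (auto simp: card_2_iff)
    then show "G x y = G x x * 0"
      using e colouring[of x y] by (auto simp: G_def)
  next
    show "(\<lambda>_. 0) \<in> IND (link_verts V E x) (link_edges (Suc (Suc 0)) V E x)"
      by (intro zero_in_IND finite_subset[OF _ assms(1)]) (auto simp: link_verts_def link_edges_def)
  qed
  ultimately show ?thesis
    unfolding theta_body.simps mem_Collect_eq
    by (intro conjI exI[of _ G]) (simp_all add: G_def)
qed

section \<open>Stars and triangles in the complete graph\<close>

lemma finite_complete_edges [simp]: "finite (complete_edges n)"
  by (rule finite_subset[of _ "Pow {1..n}"]) (auto simp: complete_edges_def)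

lemma card_complete_edges: "real (card (complete_edges n)) = real n * (real n - 1) / 2"
proof -
  have "card (complete_edges n) = n choose 2"
    unfolding complete_edges_def using n_subsets[of "{1..n}" 2] by simp
  also have "real \<dots> = real n * (real n - 1) / 2"
    by (cases n) (simp_all add: choose_two real_of_nat_div algebra_simps)
  finally show ?thesis .
qed

lemma complete_edgesE:
  assumes "e \<in> complete_edges n"
  obtains a b where "e = {a, b}" "a \<noteq> b" "a \<in> {1..n}" "b \<in> {1..n}"
  using assms by (auto simp: complete_edges_def card_2_iff)

definition star :: "nat \<Rightarrow> nat \<Rightarrow> nat set set" where
  "star n i = {e \<in> complete_edges n. i \<in> e}"

lemma finite_star [simp]: "finite (star n i)"
  by (simp add: star_def)

lemma star_eq:
  assumes "i \<in> {1..n}"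
  shows "star n i = (\<lambda>j. {i, j}) ` ({1..n} - {i})"
  using assms by (auto simp: star_def complete_edges_def card_2_iff)

lemma sum_star:
  assumes "i \<in> {1..n}"
  shows "(\<Sum>e\<in>star n i. u e) = (\<Sum>j\<in>{1..n} - {i}. u {i, j})"
  unfolding star_eq[OF assms]
  by (subst sum.reindex) (auto simp: inj_on_def doubleton_eq_iff)

lemma sum_incidences:
  "(\<Sum>e\<in>complete_edges n. \<Sum>i\<in>e. u i e) = (\<Sum>i\<in>{1..n}. \<Sum>e\<in>star n i. u i e)"
proof -
  have "{i \<in> {1..n}. i \<in> e} = e" if "e \<in> complete_edges n" for e
    using that unfolding complete_edges_def by blast
  then have "(\<Sum>e\<in>complete_edges n. \<Sum>i\<in>e. u i e)
      = (\<Sum>e\<in>complete_edges n. \<Sum>i\<in>{i\<in>{1..n}. i \<in> e}. u i e)"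
    by (intro sum.cong[OF refl]) (simp only:)
  also have "\<dots> = (\<Sum>i\<in>{1..n}. \<Sum>e\<in>star n i. u i e)"
    unfolding star_def by (rule sum.swap_restrict) auto
  finally show ?thesis .
qed

lemma sum_stars:
  fixes u :: "nat set \<Rightarrow> real"
  shows "(\<Sum>i\<in>{1..n}. \<Sum>e\<in>star n i. u e) = 2 * (\<Sum>e\<in>complete_edges n. u e)"
proof -
  have "(\<Sum>e\<in>complete_edges n. \<Sum>i\<in>e. u e) = (\<Sum>e\<in>complete_edges n. 2 * u e)"
    by (intro sum.cong) (auto simp: complete_edges_def)
  then show ?thesis
    by (simp only: sum_incidences sum_distrib_left)
qed

lemma filter_insert:
  "{g \<in> insert x A. P g} = (if P x then insert x {g \<in> A. P g} else {g \<in> A. P g})"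
  by auto

lemma triangle_two_edges_at_point:
  assumes "t \<in> triangle_edges n" "e \<in> t" "a \<in> e"
  shows "card {g \<in> t. a \<in> g} = 2"
proof -
  obtain p q r where t: "t = {{p, q}, {q, r}, {p, r}}"
    and pqr: "p \<noteq> q" "q \<noteq> r" "p \<noteq> r"
    using assms(1) unfolding triangle_edges_def by blast
  have "a = p \<or> a = q \<or> a = r"
    using assms(2,3) unfolding t by blast
  moreover have "{p, q} \<noteq> {p, r}" "{p, q} \<noteq> {q, r}" "{q, r} \<noteq> {p, r}"
    using pqr by (simp_all add: doubleton_eq_iff)
  ultimately show ?thesis
    using pqr pqr[symmetric] unfolding t filter_insert by (elim disjE) simp_all
qed

lemma triangle_link:
  assumes "a \<in> {1..n}" "b \<in> {1..n}" "c \<in> {1..n}" "a \<noteq> b" "c \<noteq> a" "c \<noteq> b"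
  defines "W \<equiv> link_verts (complete_edges n) (triangle_edges n) {a, b}"
  shows "{a, c} \<in> W" "{b, c} \<in> W"
    "{{a, c}, {b, c}} \<in> link_edges (Suc (Suc (Suc 0))) (complete_edges n) (triangle_edges n) {a, b}"
proof -
  have T: "{{a, b}, {a, c}, {b, c}} \<in> triangle_edges n"
    unfolding triangle_edges_def mem_Collect_eq
    by (rule exI[of _ b], rule exI[of _ a], rule exI[of _ c])
      (use assms(1-6) in \<open>simp add: insert_commute[of a b]\<close>)
  have "{a, c} \<in> complete_edges n" "{b, c} \<in> complete_edges n"
    using assms(1-6) by (auto simp: complete_edges_def)
  moreover have distinct: "{a, c} \<noteq> {a, b}" "{b, c} \<noteq> {a, b}" "{a, c} \<noteq> {b, c}"
    using assms(4-6) by (auto simp: doubleton_eq_iff)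
  ultimately show W: "{a, c} \<in> W" "{b, c} \<in> W"
    unfolding W_def link_verts_def by (intro CollectI conjI DiffI bexI[OF _ T]; simp)+
  show "{{a, c}, {b, c}}
      \<in> link_edges (Suc (Suc (Suc 0))) (complete_edges n) (triangle_edges n) {a, b}"
    unfolding link_edges_def using T W distinct(3) by (simp add: W_def)
qed

lemma triangle_link_verts_meet:
  assumes "y \<in> link_verts (complete_edges n) (triangle_edges n) x"
  shows "y \<noteq> x" "y \<inter> x \<noteq> {}"
  using assms by (auto simp: link_verts_def triangle_edges_def)

text \<open>
  The stars of \<open>a\<close> and of \<open>b\<close> are the two sides of the perfect matching that is the link of
  \<open>{a, b}\<close>: a triangle has exactly two edges at \<open>a\<close>, one of which is \<open>{a, b}\<close>.
\<close>

lemma triangle_link_edges_colouring: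
  assumes "{y, z} \<in> link_edges r (complete_edges n) (triangle_edges n) {a, b}" "y \<noteq> z"
  shows "a \<in> y \<longleftrightarrow> a \<notin> z"
proof -
  let ?t = "{{a, b}, y, z}"
  have t: "?t \<in> triangle_edges n" "y \<noteq> {a, b}" "z \<noteq> {a, b}"
    using assms(1) by (simp_all add: link_edges_def link_verts_def)
  have "card {g \<in> ?t. a \<in> g} = 2"
    using triangle_two_edges_at_point[OF t(1), of "{a, b}" a] by simp
  then show ?thesis
    using t(2,3)[symmetric] assms(2) unfolding filter_insert
    by (cases "a \<in> y"; cases "a \<in> z") simp_all
qed

section \<open>The upper bound\<close>

lemma triangle_inequality_matrix:
  assumes rows: "\<And>x. x \<in> complete_edges n \<Longrightarrow>
      link_verts (complete_edges n) (triangle_edges n) x \<noteq> {} \<Longrightarrow>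
      \<exists>g\<in>theta_body (Suc (Suc 0)) (link_verts (complete_edges n) (triangle_edges n) x)
          (link_edges (Suc (Suc (Suc 0))) (complete_edges n) (triangle_edges n) x).
        \<forall>y\<in>link_verts (complete_edges n) (triangle_edges n) x. F x y = F x x * g y"
    and psd: "psd_on (insert None (Some ` complete_edges n)) (bordered F)"
    and abc: "a \<in> {1..n}" "b \<in> {1..n}" "c \<in> {1..n}" "a \<noteq> b" "c \<noteq> a" "c \<noteq> b"
  shows "F {a, b} {a, c} + F {a, b} {b, c} \<le> F {a, b} {a, b}"
proof -
  let ?W = "link_verts (complete_edges n) (triangle_edges n) {a, b}"
  have x: "{a, b} \<in> complete_edges n" using abc by (auto simp: complete_edges_def)
  obtain g where g: "g \<in> theta_body (Suc (Suc 0)) ?W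
      (link_edges (Suc (Suc (Suc 0))) (complete_edges n) (triangle_edges n) {a, b})"
    "\<forall>y\<in>?W. F {a, b} y = F {a, b} {a, b} * g y"
    using rows[OF x] triangle_link(1)[OF abc] by blast
  have "finite ?W"
    by (rule finite_subset[of _ "complete_edges n"]) (auto simp: link_verts_def)
  then have "g {a, c} + g {b, c} \<le> 1"
    by (rule theta_body_two_edge[OF _ g(1) triangle_link(1,2)[OF abc] _ triangle_link(3)[OF abc]])
      (use abc in \<open>simp add: doubleton_eq_iff\<close>)
  moreover have "0 \<le> F {a, b} {a, b}"
    by (rule psd_bordered_diagonal[OF _ psd x]) simp
  ultimately have "F {a, b} {a, b} * (g {a, c} + g {b, c}) \<le> F {a, b} {a, b} * 1"
    by (rule mult_left_mono)
  moreover have "F {a, b} {a, c} = F {a, b} {a, b} * g {a, c}"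
    "F {a, b} {b, c} = F {a, b} {a, b} * g {b, c}"
    using g(2) triangle_link(1,2)[OF abc] by blast+
  ultimately show ?thesis
    by (simp only: distrib_left mult_1_right)
qed

text \<open>
  For \<open>e = {a, b}\<close> the two stars share \<open>e\<close>, which contributes \<open>2 F e e\<close>; the other \<open>n - 2\<close>
  points \<open>c\<close> contribute at most \<open>F e e\<close> each, through the triangle \<open>a, b, c\<close>.
\<close>

lemma star_rows_bound:
  fixes F :: "nat set \<Rightarrow> nat set \<Rightarrow> real"
  assumes triangle: "\<And>a b c. \<lbrakk>a \<in> {1..n}; b \<in> {1..n}; c \<in> {1..n}; a \<noteq> b; c \<noteq> a; c \<noteq> b\<rbrakk> \<Longrightarrow>
      F {a, b} {a, c} + F {a, b} {b, c} \<le> F {a, b} {a, b}"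
    and e: "e \<in> complete_edges n"
  shows "(\<Sum>i\<in>e. \<Sum>g\<in>star n i. F e g) \<le> real n * F e e"
proof -
  obtain a b where ab: "e = {a, b}" "a \<noteq> b" "a \<in> {1..n}" "b \<in> {1..n}"
    using complete_edgesE[OF e] by blast
  define C where "C = {1..n} - {a, b}"
  have split: "{1..n} - {a} = insert b C" "{1..n} - {b} = insert a C"
    and C: "a \<notin> C" "b \<notin> C" "finite C" "C \<subseteq> {1..n}"
    using ab by (auto simp: C_def)
  have stars: "(\<Sum>g\<in>star n a. F e g) = F e e + (\<Sum>c\<in>C. F e {a, c})"
    "(\<Sum>g\<in>star n b. F e g) = F e e + (\<Sum>c\<in>C. F e {b, c})"
    unfolding sum_star[OF ab(3)] sum_star[OF ab(4)] split
    using C by (simp_all add: ab(1) insert_commute)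
  have "(\<Sum>i\<in>e. \<Sum>g\<in>star n i. F e g)
      = (\<Sum>g\<in>star n a. F e g) + (\<Sum>g\<in>star n b. F e g)"
    using ab(2) by (simp add: ab(1))
  also have "\<dots> = 2 * F e e + (\<Sum>c\<in>C. F e {a, c} + F e {b, c})"
    by (simp add: stars sum.distrib)
  also have "\<dots> \<le> 2 * F e e + (\<Sum>c\<in>C. F e e)"
    unfolding ab(1) using ab(2-4) C by (intro add_left_mono sum_mono triangle) auto
  also have "\<dots> = real n * F e e"
  proof -
    have "card C = n - 2" "n \<ge> 2"
      using ab card_mono[of "{1..n}" "{a, b}"] by (auto simp: C_def card_Diff_subset)
    then show ?thesis by (simp add: of_nat_diff algebra_simps)
  qed
  finally show ?thesis .
qed

lemma theta_body_triangle_upper: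
  assumes "n > 0" "f \<in> theta_body (Suc (Suc (Suc 0))) (complete_edges n) (triangle_edges n)"
  shows "(\<Sum>x\<in>complete_edges n. f x) \<le> (real n)\<^sup>2 / 4"
proof -
  let ?V = "complete_edges n"
  obtain F where F: "\<forall>x\<in>?V. f x = F x x"
    "\<And>x. x \<in> ?V \<Longrightarrow> link_verts ?V (triangle_edges n) x \<noteq> {} \<Longrightarrow>
      \<exists>g\<in>theta_body (Suc (Suc 0)) (link_verts ?V (triangle_edges n) x)
          (link_edges (Suc (Suc (Suc 0))) ?V (triangle_edges n) x).
        \<forall>y\<in>link_verts ?V (triangle_edges n) x. F x y = F x x * g y"
    "psd_on (insert None (Some ` ?V)) (bordered F)"
    using assms(2) by (simp only: theta_body.simps mem_Collect_eq) blast
  define t where "t = (\<Sum>x\<in>?V. F x x)"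
  have star_test: "0 \<le> (real n)\<^sup>2 / 4 - real n * (\<Sum>e\<in>star n i. F e e)
      + (\<Sum>e\<in>star n i. \<Sum>g\<in>star n i. F e g)" for i
  proof -
    define v :: "nat set \<Rightarrow> real" where "v = (\<lambda>e. if i \<in> e then 1 else 0)"
    have restrict: "(\<Sum>e\<in>?V. h e * v e) = (\<Sum>e\<in>star n i. h e)" for h :: "nat set \<Rightarrow> real"
      unfolding star_def v_def by (simp add: sum.inter_filter if_distrib cong: if_cong)
    have "0 \<le> (- real n / 2)\<^sup>2 + 2 * (- real n / 2) * (\<Sum>x\<in>?V. F x x * v x)
        + (\<Sum>x\<in>?V. \<Sum>y\<in>?V. v x * F x y * v y)"
      using F(3) unfolding psd_bordered_iff[OF finite_complete_edges] by blast
    moreover have "(\<Sum>x\<in>?V. \<Sum>y\<in>?V. v x * F x y * v y) = (\<Sum>x\<in>?V. (\<Sum>y\<in>?V. F x y * v y) * v x)"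
      by (simp add: sum_distrib_left mult_ac)
    ultimately show ?thesis by (simp add: restrict power2_eq_square)
  qed
  have "0 \<le> (\<Sum>i\<in>{1..n}. (real n)\<^sup>2 / 4 - real n * (\<Sum>e\<in>star n i. F e e)
      + (\<Sum>e\<in>star n i. \<Sum>g\<in>star n i. F e g))"
    by (intro sum_nonneg star_test)
  also have "\<dots> = real n * ((real n)\<^sup>2 / 4) - 2 * real n * t
      + (\<Sum>e\<in>?V. \<Sum>i\<in>e. \<Sum>g\<in>star n i. F e g)"
    by (simp add: sum.distrib sum_subtractf sum_distrib_left[symmetric] sum_stars sum_incidences t_def
        del: One_nat_def)
  also have "(\<Sum>e\<in>?V. \<Sum>i\<in>e. \<Sum>g\<in>star n i. F e g) \<le> (\<Sum>e\<in>?V. real n * F e e)"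
    using triangle_inequality_matrix[OF F(2,3)] by (intro sum_mono star_rows_bound)
  also have "(\<Sum>e\<in>?V. real n * F e e) = real n * t"
    by (simp add: t_def sum_distrib_left)
  finally have "0 \<le> real n * ((real n)\<^sup>2 / 4 - t)"
    by (simp add: algebra_simps)
  then have "t \<le> (real n)\<^sup>2 / 4"
    using assms(1) by (simp add: zero_le_mult_iff)
  then show ?thesis using F(1) by (simp add: t_def)
qed

section \<open>The lower bound\<close>

text \<open>
  Expanding the squares, each \<open>s i * s i\<close> occurs for the \<open>n - 1\<close> edges at \<open>i\<close> and each
  \<open>s i * s j\<close> with \<open>i \<noteq> j\<close> for the single edge \<open>{i, j}\<close>.
\<close>

lemma sum_pairs_square:
  fixes s :: "nat \<Rightarrow> real"
  shows "(\<Sum>e\<in>complete_edges n. (\<Sum>i\<in>e. s i)\<^sup>2)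
    = (real n - 2) * (\<Sum>i\<in>{1..n}. (s i)\<^sup>2) + (\<Sum>i\<in>{1..n}. s i)\<^sup>2"
proof -
  have row: "(\<Sum>e\<in>star n i. s i * (\<Sum>j\<in>e. s j))
      = (real n - 2) * (s i)\<^sup>2 + s i * (\<Sum>j\<in>{1..n}. s j)" if i: "i \<in> {1..n}" for i
  proof -
    have "(\<Sum>e\<in>star n i. s i * (\<Sum>j\<in>e. s j)) = (\<Sum>j\<in>{1..n} - {i}. s i * (s i + s j))"
      unfolding sum_star[OF i] by (intro sum.cong) auto
    also have "\<dots> = (real n - 1) * (s i)\<^sup>2 + s i * (\<Sum>j\<in>{1..n} - {i}. s j)"
      using i by (simp add: distrib_left sum.distrib sum_distrib_left power2_eq_square of_nat_diff)
    also have "(\<Sum>j\<in>{1..n} - {i}. s j) = (\<Sum>j\<in>{1..n}. s j) - s i"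
      using i by (simp add: sum_diff1)
    finally show ?thesis by (simp add: power2_eq_square algebra_simps)
  qed
  have "(\<Sum>e\<in>complete_edges n. (\<Sum>i\<in>e. s i)\<^sup>2)
      = (\<Sum>e\<in>complete_edges n. \<Sum>i\<in>e. s i * (\<Sum>j\<in>e. s j))"
    by (simp add: power2_eq_square sum_distrib_right)
  also have "\<dots> = (\<Sum>i\<in>{1..n}. \<Sum>e\<in>star n i. s i * (\<Sum>j\<in>e. s j))"
    by (rule sum_incidences)
  also have "\<dots> = (\<Sum>i\<in>{1..n}. (real n - 2) * (s i)\<^sup>2 + s i * (\<Sum>j\<in>{1..n}. s j))"
    using row by (intro sum.cong) auto
  finally show ?thesis
    by (simp add: sum.distrib sum_distrib_left[symmetric] sum_distrib_right[symmetric] power2_eq_square)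
qed

text \<open>
  The vector \<open>w e = (\<Sum>i\<in>e. s i) / (n - 2) - 2 T / ((n - 1) (n - 2))\<close> is the orthogonal
  projection of \<open>v\<close> onto the span of the stars, and the inequality is
  \<open>0 \<le> \<parallel>v - w\<parallel>\<^sup>2 = \<parallel>v\<parallel>\<^sup>2 - \<langle>v, w\<rangle>\<close>.
\<close>

lemma star_sums_square_bound:
  fixes v :: "nat set \<Rightarrow> real"
  assumes "n > 2"
  defines "T \<equiv> \<Sum>e\<in>complete_edges n. v e"
  shows "(\<Sum>i\<in>{1..n}. (\<Sum>e\<in>star n i. v e)\<^sup>2) / (real n - 2) - 2 * T\<^sup>2 / ((real n - 1) * (real n - 2))
    \<le> (\<Sum>e\<in>complete_edges n. (v e)\<^sup>2)"
proof -
  let ?V = "complete_edges n"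
  define N where "N = real n"
  have N: "N > 2" using assms(1) by (simp add: N_def)
  define s where "s = (\<lambda>i. \<Sum>e\<in>star n i. v e)"
  define p where "p = (\<lambda>e. \<Sum>i\<in>e. s i)"
  define S where "S = (\<Sum>i\<in>{1..n}. (s i)\<^sup>2)"
  define \<mu> where "\<mu> = 1 / (N - 2)"
  define \<kappa> where "\<kappa> = 2 * T / ((N - 1) * (N - 2))"
  have total: "(\<Sum>i\<in>{1..n}. s i) = 2 * T"
    by (simp add: s_def sum_stars T_def del: One_nat_def)
  have vp: "(\<Sum>e\<in>?V. v e * p e) = S"
  proof -
    have "(\<Sum>e\<in>?V. v e * p e) = (\<Sum>i\<in>{1..n}. \<Sum>e\<in>star n i. s i * v e)"
      unfolding sum_incidences[symmetric] by (simp add: p_def sum_distrib_left mult.commute)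
    then show ?thesis
      by (simp add: S_def s_def power2_eq_square sum_distrib_left)
  qed
  have pp: "(\<Sum>e\<in>?V. (p e)\<^sup>2) = (N - 2) * S + 4 * T\<^sup>2"
    unfolding p_def sum_pairs_square total by (simp add: S_def N_def)
  have p1: "(\<Sum>e\<in>?V. p e) = (N - 1) * (2 * T)"
  proof -
    have "(\<Sum>e\<in>?V. p e) = (\<Sum>i\<in>{1..n}. real (card (star n i)) * s i)"
      unfolding p_def sum_incidences by simp
    also have "\<dots> = (\<Sum>i\<in>{1..n}. (N - 1) * s i)"
    proof (intro sum.cong refl)
      fix i assume i: "i \<in> {1..n}"
      have "real (card (star n i)) = N - 1"
        using sum_star[OF i, of "\<lambda>_. 1 :: real"] i by (simp add: N_def of_nat_diff)
      then show "real (card (star n i)) * s i = (N - 1) * s i" by simp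
    qed
    finally show ?thesis by (simp add: sum_distrib_left[symmetric] total del: One_nat_def)
  qed
  have one: "real (card ?V) = N * (N - 1) / 2"
    by (simp add: card_complete_edges N_def)
  have "0 \<le> (\<Sum>e\<in>?V. (v e - (\<mu> * p e - \<kappa>))\<^sup>2)"
    by (intro sum_nonneg) simp
  also have "\<dots> = (\<Sum>e\<in>?V. (v e)\<^sup>2 - 2 * \<mu> * (v e * p e) + 2 * \<kappa> * v e
      + \<mu>\<^sup>2 * (p e)\<^sup>2 - 2 * \<mu> * \<kappa> * p e + \<kappa>\<^sup>2)"
    by (intro sum.cong) (simp_all add: power2_eq_square algebra_simps)
  also have "\<dots> = (\<Sum>e\<in>?V. (v e)\<^sup>2) - 2 * \<mu> * S + 2 * \<kappa> * T
      + \<mu>\<^sup>2 * ((N - 2) * S + 4 * T\<^sup>2) - 2 * \<mu> * \<kappa> * ((N - 1) * (2 * T)) + \<kappa>\<^sup>2 * (N * (N - 1) / 2)"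
    by (simp add: sum.distrib sum_subtractf sum_distrib_left[symmetric] vp pp p1 one
        T_def[symmetric] mult.commute[of "N * (N - 1)"])
  also have "\<dots> = (\<Sum>e\<in>?V. (v e)\<^sup>2) - (\<mu> * S - \<kappa> * T)"
  proof -
    have h: "\<mu> * (N - 2) = 1" "\<kappa> * (N - 1) = 2 * \<mu> * T"
      using N by (simp_all add: \<mu>_def \<kappa>_def)
    have "\<mu>\<^sup>2 * ((N - 2) * S) = \<mu> * (\<mu> * (N - 2)) * S"
      by (simp add: power2_eq_square)
    moreover have "2 * \<mu> * \<kappa> * ((N - 1) * (2 * T)) = 4 * \<mu> * T * (\<kappa> * (N - 1))"
      by simp
    moreover have "\<kappa>\<^sup>2 * (N * (N - 1) / 2) = \<kappa> * (\<kappa> * (N - 1)) * N / 2"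
      by (simp add: power2_eq_square)
    moreover have "\<kappa> * T + \<kappa> * \<mu> * T * N = 4 * \<mu>\<^sup>2 * T\<^sup>2"
    proof -
      have "\<kappa> * T + \<kappa> * \<mu> * T * N = \<kappa> * T * (\<mu> * (N - 2)) + \<kappa> * \<mu> * T * N"
        by (simp add: h)
      also have "\<dots> = 2 * \<mu> * T * (\<kappa> * (N - 1))"
        by (simp add: algebra_simps)
      finally show ?thesis by (simp add: h power2_eq_square)
    qed
    ultimately show ?thesis unfolding h by (simp add: power2_eq_square algebra_simps)
  qed
  finally show ?thesis
    by (simp add: \<mu>_def \<kappa>_def S_def s_def N_def power2_eq_square)
qed

lemma star_sums_square:
  fixes v :: "nat set \<Rightarrow> real"
  shows "(\<Sum>i\<in>{1..n}. (\<Sum>e\<in>star n i. v e)\<^sup>2)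
    = (\<Sum>e\<in>complete_edges n. \<Sum>g\<in>complete_edges n. v e * real (card (e \<inter> g)) * v g)"
proof -
  have "(\<Sum>i\<in>e. \<Sum>g\<in>star n i. v e * v g) = (\<Sum>g\<in>complete_edges n. v e * real (card (e \<inter> g)) * v g)"
    if "e \<in> complete_edges n" for e
  proof -
    have "finite e" using that by (auto elim: complete_edgesE)
    then have "(\<Sum>i\<in>e. \<Sum>g\<in>star n i. v e * v g)
        = (\<Sum>g\<in>complete_edges n. \<Sum>i\<in>{i\<in>e. i \<in> g}. v e * v g)"
      unfolding star_def by (intro sum.swap_restrict) auto
    then show ?thesis by (simp add: Int_def mult_ac)
  qed
  then have "(\<Sum>e\<in>complete_edges n. \<Sum>i\<in>e. \<Sum>g\<in>star n i. v e * v g)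
      = (\<Sum>e\<in>complete_edges n. \<Sum>g\<in>complete_edges n. v e * real (card (e \<inter> g)) * v g)"
    by (rule sum.cong[OF refl])
  then show ?thesis
    by (simp add: sum_incidences power2_eq_square sum_product)
qed

lemma card_edge_inter:
  assumes "e \<in> complete_edges n" "g \<in> complete_edges n"
  shows "card (e \<inter> g) = (if e = g then 2 else if e \<inter> g \<noteq> {} then 1 else 0)"
proof -
  obtain a b c d where "e = {a, b}" "a \<noteq> b" "g = {c, d}" "c \<noteq> d"
    using assms by (auto elim!: complete_edgesE)
  then show ?thesis
    by (auto simp: Int_insert_left doubleton_eq_iff)
qed

lemma theta_body_triangle_lower:
  assumes "n \<ge> 4"
  shows "\<exists>f\<in>theta_body (Suc (Suc (Suc 0))) (complete_edges n) (triangle_edges n).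
    (\<Sum>x\<in>complete_edges n. f x) = (real n)\<^sup>2 / 4"
proof -
  let ?V = "complete_edges n" and ?E = "triangle_edges n"
  define N where "N = real n"
  have N: "N \<ge> 4" using assms by (simp add: N_def)
  define \<alpha> where "\<alpha> = N / (2 * (N - 1))"
  define \<gamma> where "\<gamma> = \<alpha> * (N - 2) / (2 * (N - 3))"
  define F :: "nat set \<Rightarrow> nat set \<Rightarrow> real" where
    "F = (\<lambda>e g. if e = g then \<alpha> else if e \<inter> g \<noteq> {} then \<alpha> / 2 else \<gamma>)"
  define f where "f = (\<lambda>x. if x \<in> ?V then \<alpha> else 0)"
  have "0 \<le> \<gamma>" using N by (simp add: \<gamma>_def \<alpha>_def)
  have psd: "psd_on (insert None (Some ` ?V)) (bordered F)"
    unfolding psd_bordered_iff[OF finite_complete_edges]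
  proof (intro conjI allI)
    show "\<forall>x\<in>?V. \<forall>y\<in>?V. F x y = F y x" by (auto simp: F_def)
  next
    fix r :: real and v :: "nat set \<Rightarrow> real"
    define T where "T = (\<Sum>e\<in>?V. v e)"
    define Q where "Q = (\<Sum>e\<in>?V. (v e)\<^sup>2)"
    define S where "S = (\<Sum>i\<in>{1..n}. (\<Sum>e\<in>star n i. v e)\<^sup>2)"
    \<comment> \<open>\<open>F\<close> is a combination of the identity, the matrix \<open>card (x \<inter> y)\<close> and the all-ones matrix.\<close>
    have "(\<Sum>x\<in>?V. \<Sum>y\<in>?V. v x * F x y * v y)
        = (\<Sum>x\<in>?V. \<Sum>y\<in>?V. \<gamma> * (if x = y then v x * v y else 0)
            + (\<alpha> / 2 - \<gamma>) * (v x * real (card (x \<inter> y)) * v y) + \<gamma> * (v x * v y))"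
      by (intro sum.cong refl) (simp add: F_def card_edge_inter algebra_simps)
    also have "\<dots> = \<gamma> * Q + (\<alpha> / 2 - \<gamma>) * S + \<gamma> * T\<^sup>2"
      unfolding Q_def S_def T_def star_sums_square
      by (simp add: sum.distrib sum_distrib_left[symmetric] sum_product power2_eq_square)
    finally have "r\<^sup>2 + 2 * r * (\<Sum>x\<in>?V. F x x * v x) + (\<Sum>x\<in>?V. \<Sum>y\<in>?V. v x * F x y * v y)
        = (r + \<alpha> * T)\<^sup>2 + (\<gamma> * Q + (\<alpha> / 2 - \<gamma>) * S + (\<gamma> - \<alpha>\<^sup>2) * T\<^sup>2)"
      by (simp add: F_def T_def sum_distrib_left[symmetric] power2_eq_square algebra_simps)
    also have "\<gamma> * Q + (\<alpha> / 2 - \<gamma>) * S + (\<gamma> - \<alpha>\<^sup>2) * T\<^sup>2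
        = \<gamma> * (Q - (S / (N - 2) - 2 * T\<^sup>2 / ((N - 1) * (N - 2))))"
    proof -
      \<comment> \<open>\<open>\<alpha>\<close> and \<open>\<gamma>\<close> are the nonzero solution of these two equations.\<close>
      have coeffs: "\<alpha> / 2 - \<gamma> = - (\<gamma> / (N - 2))" "\<gamma> - \<alpha>\<^sup>2 = 2 * \<gamma> / ((N - 1) * (N - 2))"
      proof -
        obtain M where M: "N = M + 3" "M \<ge> 1"
          using N by (intro that[of "N - 3"]) auto
        show "\<alpha> / 2 - \<gamma> = - (\<gamma> / (N - 2))"
          using M(2) unfolding \<gamma>_def M(1) by (simp add: divide_simps) (simp add: algebra_simps)
        show "\<gamma> - \<alpha>\<^sup>2 = 2 * \<gamma> / ((N - 1) * (N - 2))"
          using M(2) unfolding \<gamma>_def \<alpha>_def M(1)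
          by (simp add: divide_simps power2_eq_square) (simp add: algebra_simps)
      qed
      show ?thesis unfolding coeffs by (simp add: right_diff_distrib)
    qed
    finally have eq: "r\<^sup>2 + 2 * r * (\<Sum>x\<in>?V. F x x * v x) + (\<Sum>x\<in>?V. \<Sum>y\<in>?V. v x * F x y * v y)
        = (r + \<alpha> * T)\<^sup>2 + \<gamma> * (Q - (S / (N - 2) - 2 * T\<^sup>2 / ((N - 1) * (N - 2))))" .
    have "0 \<le> Q - (S / (N - 2) - 2 * T\<^sup>2 / ((N - 1) * (N - 2)))"
      using star_sums_square_bound[of n v] assms by (simp add: Q_def S_def T_def N_def)
    then show "0 \<le> r\<^sup>2 + 2 * r * (\<Sum>x\<in>?V. F x x * v x) + (\<Sum>x\<in>?V. \<Sum>y\<in>?V. v x * F x y * v y)"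
      unfolding eq using \<open>0 \<le> \<gamma>\<close> by (intro add_nonneg_nonneg mult_nonneg_nonneg) auto
  qed
  have rows: "\<exists>g\<in>theta_body (Suc (Suc 0)) (link_verts ?V ?E x) (link_edges (Suc (Suc (Suc 0))) ?V ?E x).
      \<forall>y\<in>link_verts ?V ?E x. F x y = F x x * g y" if x: "x \<in> ?V" for x
  proof -
    obtain a b where ab: "x = {a, b}" "a \<noteq> b"
      using complete_edgesE[OF x] by blast
    have "finite (link_verts ?V ?E x)"
      by (rule finite_subset[of _ ?V]) (auto simp: link_verts_def)
    then have half: "(\<lambda>y. if y \<in> link_verts ?V ?E x then 1 / 2 else 0)
        \<in> theta_body (Suc (Suc 0)) (link_verts ?V ?E x) (link_edges (Suc (Suc (Suc 0))) ?V ?E x)"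
      unfolding ab(1)
    proof (rule theta_body_two_half[where P = "\<lambda>y. a \<in> y"])
      show "card e = 2" if "e \<in> link_edges (Suc (Suc (Suc 0))) ?V ?E {a, b}" for e
        using that by (simp add: link_edges_def)
    qed (rule triangle_link_edges_colouring)
    have "F x y = F x x * (1 / 2)" if "y \<in> link_verts ?V ?E x" for y
      using triangle_link_verts_meet[OF that] by (auto simp: F_def)
    then show ?thesis by (intro bexI[OF _ half]) simp
  qed
  have "f \<in> theta_body (Suc (Suc (Suc 0))) ?V ?E"
  proof (subst theta_body.simps(2), intro CollectI conjI exI[of _ F])
    show "\<forall>x\<in>?V. link_verts ?V ?E x \<noteq> {} \<longrightarrow>
        (\<exists>g\<in>theta_body (Suc (Suc 0)) (link_verts ?V ?E x) (link_edges (Suc (Suc (Suc 0))) ?V ?E x).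
          \<forall>y\<in>link_verts ?V ?E x. F x y = F x x * g y)"
      using rows by blast
  qed (use psd in \<open>simp_all add: f_def F_def\<close>)
  moreover have "(\<Sum>x\<in>?V. f x) = (real n)\<^sup>2 / 4"
  proof -
    have "(\<Sum>x\<in>?V. f x) = N * (N - 1) / 2 * \<alpha>"
      by (simp add: f_def card_complete_edges N_def)
    also have "\<dots> = N\<^sup>2 / 4"
      using N by (simp add: \<alpha>_def field_simps power2_eq_square)
    finally show ?thesis by (simp add: N_def)
  qed
  ultimately show ?thesis by blast
qed

theorem mainTheorem7:
  fixes n :: nat
  assumes "n \<ge> 4"
  shows "(\<exists>f\<in>theta_body 3 (complete_edges n) (triangle_edges n).
            \<forall>g\<in>theta_body 3 (complete_edges n) (triangle_edges n).
              (\<Sum>x\<in>complete_edges n. g x) \<le> (\<Sum>x\<in>complete_edges n. f x)) \<and>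
         theta_number 3 (complete_edges n) (triangle_edges n) = (real n)\<^sup>2 / 4"
proof -
  let ?TH = "theta_body 3 (complete_edges n) (triangle_edges n)"
  have upper: "(\<Sum>x\<in>complete_edges n. g x) \<le> (real n)\<^sup>2 / 4" if "g \<in> ?TH" for g
    using theta_body_triangle_upper[of n g] that assms by (simp only: numeral_3_eq_3)
  obtain f where f: "f \<in> ?TH" "(\<Sum>x\<in>complete_edges n. f x) = (real n)\<^sup>2 / 4"
    using theta_body_triangle_lower[OF assms] by (auto simp only: numeral_3_eq_3)
  have "theta_number 3 (complete_edges n) (triangle_edges n) = (real n)\<^sup>2 / 4"
    unfolding theta_number_def
  proof (rule Greatest_equality)
    show "\<exists>f\<in>?TH. (real n)\<^sup>2 / 4 = (\<Sum>x\<in>complete_edges n. f x)"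
      using f by (intro bexI[of _ f]) simp_all
  qed (use upper in auto)
  then show ?thesis
    using f upper by metis
qed

end
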